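(* Let $r,\ell\ge0$ be integers. Among all sequences $a_0,\dots,a_r$ of nonnegative integers with $a_0+\dots+a_r=\ell$, the minimum value of every coefficient of $$\prod_{i=0}^{r}H_{a_i}(z,q)$$ is achieved by the equitable sequences, that is, those in which $|a_i-a_j|\le1$ for every $i,j\in\{0,\dots,r\}$. In other words, if $(a_i)_{i=0}^r$ is equitable with sum $\ell$ and $(b_i)_{i=0}^r$ is any sequence of nonnegative integers with sum $\ell$, then for all $n,c\ge0$ the coefficient of $z^nq^c$ in $\prod_{i=0}^r H_{a_i}(z,q)$ is at most the coefficient of $z^nq^c$ in $\prod_{i=0}^r H_{b_i}(z,q)$.
   Context: $H(z,q)$ is the formal power series $$H(z,q)=\frac{2}{2-q+q\sqrt{1-4z}}.$$ For each integer $j\ge0$, $\Omega_j$ is the linear operator on formal power series in $z$ (acting coefficientwise, with $q$ treated as a constant) given by $\Omega_j[z^n]=\binom{n+j}{j}z^n$, and $H_j(z,q)=\Omega_j[H(z,q)]$ (so $H_0=H$). *)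

theory Defs
  imports Complex_Main "HOL-Computational_Algebra.Formal_Power_Series"
begin

text \<open>
  Formal power series in \<open>z\<close> and \<open>q\<close> are elements of \<open>real fps fps\<close>: the outer variable is
  \<open>z\<close>, and the coefficients are power series in \<open>q\<close>.
\<close>

definition qvar :: "real fps fps" where
  "qvar = fps_const fps_X"

text \<open>
  The library's radicals need coefficients in a field, so the square root is formed over the reals
  (as the root with constant term \<open>1\<close>) and then embedded by viewing its coefficients as
  constants in \<open>q\<close>.
\<close>

definition sqrt_1_minus_4z :: "real fps fps" where
  "sqrt_1_minus_4z = Abs_fps (\<lambda>n. fps_const (fps_nth (fps_radical root 2 (1 - 4 * fps_X)) n))"

definition H :: "real fps fps" where
  "H = 2 / (2 - qvar + qvar * sqrt_1_minus_4z)"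

definition Omega :: "nat \<Rightarrow> real fps fps \<Rightarrow> real fps fps" where
  "Omega j F = Abs_fps (\<lambda>n. of_nat ((n + j) choose j) * fps_nth F n)"

definition Hj :: "nat \<Rightarrow> real fps fps" where
  "Hj j = Omega j H"

definition equitable :: "nat \<Rightarrow> (nat \<Rightarrow> nat) \<Rightarrow> bool" where
  "equitable r a \<longleftrightarrow> (\<forall>i\<in>{0..r}. \<forall>j\<in>{0..r}. \<bar>int (a i) - int (a j)\<bar> \<le> 1)"

text \<open>
  The ring \<open>real fps\<close> is not a field, so division in \<open>real fps fps\<close> is only partially
  meaningful. The denominator in \<open>H\<close> has constant term \<open>2\<close>, a unit of \<open>real fps\<close>, and the
  quotient is the intended one:
\<close>

lemma sqrt_1_minus_4z_0: "fps_nth sqrt_1_minus_4z 0 = 1"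
  by (simp add: sqrt_1_minus_4z_def)

lemma sqrt_1_minus_4z_square: "sqrt_1_minus_4z ^ 2 = 1 - 4 * fps_X"
proof -
  let ?S = "fps_radical root 2 (1 - 4 * fps_X :: real fps)"
  have S: "?S ^ 2 = 1 - 4 * fps_X"
    using power_radical[of "1 - 4 * fps_X :: real fps" root 1]
    by (simp add: numeral_2_eq_2)
  have "fps_nth (sqrt_1_minus_4z ^ 2) n = fps_const (fps_nth (?S ^ 2) n)" for n
    by (simp add: sqrt_1_minus_4z_def power2_eq_square fps_mult_nth fps_eq_iff fps_sum_nth)
  then show ?thesis
    unfolding S by (auto simp: fps_eq_iff numeral_fps_const fps_one_nth)
qed

lemma H_denominator: "(2 - qvar + qvar * sqrt_1_minus_4z) * H = 2"
proof -
  define D where "D = 2 - qvar + qvar * sqrt_1_minus_4z"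
  have D0: "fps_nth D 0 = 2"
    by (simp add: D_def qvar_def sqrt_1_minus_4z_0)
  have "(2::real fps) * inverse 2 = 1"
    by (rule inverse_mult_eq_1') simp
  then have "fps_nth D 0 * inverse (fps_nth D 0) = 1"
    by (simp only: D0)
  then have "D * inverse D = 1"
    unfolding fps_inverse_def[of D] by (rule fps_right_inverse)
  moreover have "H = 2 * inverse D"
    unfolding H_def D_def[symmetric] using D0 by (intro fps_divide_unit) simp
  ultimately show ?thesis
    unfolding D_def[symmetric] by (metis mult.left_commute mult.right_neutral)
qed

end

theory Submission
  imports Defs
begin

text \<open>
  With \<open>C\<close> the Catalan series and \<open>u = z C(z) = (1 - sqrt (1 - 4 z)) / 2\<close> one has
  \<open>H = 1 / (1 - q u)\<close>, so the coefficient of \<open>z\<^sup>n q\<^sup>c\<close> in \<open>H\<close> is the ballot number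
  \<open>B n c = [z\<^sup>n] u\<^sup>c\<close>.  The heart of the matter is the case of two factors
  (\<open>Hj_balance\<close>): for \<open>a \<le> b\<close> the series \<open>H\<^sub>a H\<^sub>b\<^sub>+\<^sub>1 - H\<^sub>a\<^sub>+\<^sub>1 H\<^sub>b\<close> has nonnegative
  coefficients.  Since all \<open>H\<^sub>j\<close> have nonnegative coefficients, this may be multiplied by the other
  factors, and an arbitrary sequence is carried to an equitable one with the same sum by
  transferring units from a larger entry to a smaller one.

  Write \<open>P i\<close> for the coefficient of \<open>z\<^sup>i\<close> in \<open>H\<close>, a polynomial in \<open>q\<close>.  Pascal's rule makes the
  difference of the binomial weights in \<open>H\<^sub>a H\<^sub>b\<^sub>+\<^sub>1\<close> and \<open>H\<^sub>a\<^sub>+\<^sub>1 H\<^sub>b\<close> telescope, and summation by parts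
  (\<open>Hj_balance_nth\<close>) turns the coefficient of \<open>z\<^sup>n\<^sup>+\<^sup>1\<close> into the sum over \<open>i + j = n\<close> of
  \<open>T i j * V i j\<close>, where \<open>T i j = binom (i + a + 1) (a + 1) * binom (j + b + 1) (b + 1)\<close> and
  \<open>V i j = P i * P (j + 1) - P (i + 1) * P j\<close>.  As \<open>V\<close> changes sign when \<open>i\<close> and \<open>j\<close> are exchanged,
  twice this sum is the sum of \<open>(T i j - T j i) * V i j\<close>, and every term of the latter is
  nonnegative because for \<open>i \<le> j\<close> both factors are: the first by \<open>binomial_tp2\<close>, the second by
  \<open>H_minor_nonneg\<close>.

  That \<open>V i j\<close> has nonnegative coefficients for \<open>i \<le> j\<close>, a log-convexity property of the \<open>P i\<close>,
  rests on the recurrence \<open>(q - 1) P (n + 1) = q\<^sup>2 P n - q B (n + 1) 1\<close>.  It linearises the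
  quadratic expression: \<open>q V i j = B (i + 1) 1 * P (j + 1) - B (j + 1) 1 * P (i + 1)\<close>
  (\<open>H_minor\<close>).  What remains is the monotonicity of \<open>B n c / B n 1\<close> in \<open>n\<close>
  (\<open>zcat_power_tp2\<close>), which is read off from the explicit ratio \<open>B n (c + 1) / B n c\<close>.
\<close>

section \<open>Ballot numbers as coefficients of powers of the Catalan series\<close>

text \<open>
  This is the series \<open>u = z C(z)\<close>, \<open>C\<close> being the generating function of the Catalan numbers.
\<close>

definition zcat :: "real fps" where
  "zcat = fps_const (1/2) * (1 - fps_radical root 2 (1 - 4 * fps_X))"

lemma zcat_minus_square: "zcat - zcat\<^sup>2 = fps_X"
proof -
  let ?S = "fps_radical root 2 (1 - 4 * fps_X :: real fps)"
  have S: "?S ^ 2 = 1 - 4 * fps_X"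
    using power_radical[of "1 - 4 * fps_X :: real fps" root 1]
    by (simp add: numeral_2_eq_2)
  have two_zcat: "2 * zcat = 1 - ?S"
    by (simp add: zcat_def numeral_fps_const flip: mult.assoc)
  have "4 * (zcat - zcat\<^sup>2) = 2 * (2 * zcat) - (2 * zcat)\<^sup>2"
    by (simp add: power2_eq_square algebra_simps)
  also have "\<dots> = 4 * fps_X"
    unfolding two_zcat using S by (simp add: power2_eq_square algebra_simps)
  finally show ?thesis
    by (metis mult_left_cancel zero_neq_numeral)
qed

lemma zcat_nth_0: "fps_nth zcat 0 = 0"
  by (simp add: zcat_def)

lemma zcat_power_rec: "zcat ^ Suc (Suc d) = zcat ^ Suc d - fps_X * zcat ^ d"
  by (simp add: algebra_simps power2_eq_square flip: zcat_minus_square)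

lemma zcat_nonneg: "fps_nth zcat n \<ge> 0"
proof (induction n rule: less_induct)
  case (less n)
  have "zcat = fps_X + zcat * zcat"
    by (simp add: algebra_simps power2_eq_square flip: zcat_minus_square)
  then have "fps_nth zcat n = fps_nth fps_X n + (\<Sum>i=0..n. fps_nth zcat i * fps_nth zcat (n - i))"
    by (metis fps_add_nth fps_mult_nth)
  moreover have "fps_nth zcat i * fps_nth zcat (n - i) \<ge> 0" if "i \<le> n" for i
  proof (cases "i = 0 \<or> i = n")
    case True
    then show ?thesis by (auto simp: zcat_nth_0)
  next
    case False
    then show ?thesis using that less.IH[of i] less.IH[of "n - i"] by simp
  qed
  then have "(\<Sum>i=0..n. fps_nth zcat i * fps_nth zcat (n - i)) \<ge> 0"
    by (intro sum_nonneg) auto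
  ultimately show ?case
    by (auto simp: fps_X_def)
qed

lemma zcat_power_nonneg: "fps_nth (zcat ^ d) n \<ge> 0"
proof (induction d arbitrary: n)
  case 0
  then show ?case by (simp add: fps_one_nth)
next
  case (Suc d)
  then show ?case by (simp add: fps_mult_nth sum_nonneg zcat_nonneg)
qed

text \<open>
  Closed form of the ratio of consecutive ballot numbers.  Because \<open>z = u (1 - u)\<close>,
  the Euler operator \<open>z d/dz\<close> maps \<open>u\<^sup>k\<close> to \<open>k u\<^sup>k (1 - u) u'\<close>, where
  \<open>u' (1 - 2 u) = 1\<close>.  Hence both sides are coefficients of the same series
  \<open>c (c + 1) u\<^sup>c\<^sup>+\<^sup>1 u'\<close>.
\<close>

lemma zcat_power_ratio:
  "real c * (2 * real n - real c - 1) * fps_nth (zcat ^ Suc c) n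
    = (real c + 1) * (real n - real c) * fps_nth (zcat ^ c) n"
proof -
  define W where "W = fps_deriv zcat"
  have W: "W * (1 - 2 * zcat) = 1"
  proof -
    have "fps_deriv (zcat - zcat\<^sup>2) = 1"
      by (simp add: zcat_minus_square)
    then show ?thesis
      by (simp add: W_def power2_eq_square algebra_simps)
  qed
  have euler: "fps_X * fps_deriv (zcat ^ k) = of_nat k * zcat ^ k * ((1 - zcat) * W)" for k
  proof (cases k)
    case (Suc m)
    have "fps_deriv (zcat ^ k) = of_nat k * (W * zcat ^ m)"
      unfolding fps_deriv_power W_def Suc fps_of_nat by simp
    then show ?thesis
      by (simp only: zcat_minus_square[symmetric]) (simp add: Suc power2_eq_square algebra_simps)
  qed simp
  have c1: "2 * ((1 - zcat) * W) - 1 = W" "(1 - zcat) * W - 1 = zcat * W"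
    using W by (simp_all add: algebra_simps)
  have "of_nat c * (2 * (fps_X * fps_deriv (zcat ^ Suc c)) - of_nat (Suc c) * zcat ^ Suc c)
      = of_nat c * of_nat (Suc c) * zcat ^ Suc c * (2 * ((1 - zcat) * W) - 1)"
    unfolding euler by (simp add: algebra_simps)
  also have "\<dots> = of_nat (Suc c) * of_nat c * zcat ^ c * ((1 - zcat) * W - 1)"
    unfolding c1 by (simp add: algebra_simps)
  also have "\<dots> = of_nat (Suc c) * (fps_X * fps_deriv (zcat ^ c) - of_nat c * zcat ^ c)"
    unfolding euler by (simp add: algebra_simps del: of_nat_Suc)
  finally have "fps_nth (of_nat c * (2 * (fps_X * fps_deriv (zcat ^ Suc c)) - of_nat (Suc c) * zcat ^ Suc c)) n
      = fps_nth (of_nat (Suc c) * (fps_X * fps_deriv (zcat ^ c) - of_nat c * zcat ^ c)) n"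
    by simp
  then show ?thesis
    unfolding fps_mult_fps_X_deriv_shift
    by (simp add: fps_of_nat[symmetric] numeral_fps_const algebra_simps del: of_nat_Suc power_Suc)
       (simp add: algebra_simps)
qed

lemma zcat_power_nth_eq_0: "n < d \<Longrightarrow> fps_nth (zcat ^ d) n = 0"
  by (rule startsby_zero_power_prefix[rule_format]) (auto simp: zcat_nth_0)

text \<open>
  By the previous ratio, passing from exponent \<open>k\<close> to \<open>k + 1\<close> multiplies the coefficient of
  \<open>z\<^sup>x\<close>, for \<open>x > k\<close>, by a constant multiple of \<open>(x - k) / (2 x - k - 1)\<close>, and for \<open>k \<ge> 1\<close> this
  factor increases with \<open>x\<close>.
\<close>

lemma zcat_power_tp2:
  assumes "1 \<le> m" "m \<le> n"
  shows "fps_nth (zcat ^ Suc c) m * fps_nth zcat n \<le> fps_nth (zcat ^ Suc c) n * fps_nth zcat m"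
proof (induction c)
  case 0
  then show ?case by (simp add: mult.commute)
next
  case (Suc c)
  define k where "k = Suc c"
  show ?case
  proof (cases "k < m")
    case False
    then have "fps_nth (zcat ^ Suc k) m = 0"
      by (intro zcat_power_nth_eq_0) simp
    then show ?thesis
      by (simp add: zcat_power_nonneg zcat_nonneg k_def del: power_Suc)
  next
    case True
    define f where "f x = (real k + 1) / real k * ((real x - real k) / (2 * real x - real k - 1))" for x
    have k: "real k > 0"
      by (simp add: k_def)
    have pos: "2 * real x - real k - 1 > 0" if "k < x" for x
      using that by (simp add: k_def)
    have f: "fps_nth (zcat ^ Suc k) x = f x * fps_nth (zcat ^ k) x" if "k < x" for x
    proof -
      have "f x * fps_nth (zcat ^ k) x
          = (real k + 1) * (real x - real k) * fps_nth (zcat ^ k) x / (real k * (2 * real x - real k - 1))"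
        by (simp add: f_def)
      also have "\<dots> = fps_nth (zcat ^ Suc k) x"
        unfolding zcat_power_ratio[symmetric] using pos[OF that] k by simp
      finally show ?thesis ..
    qed
    have "f m \<le> f n"
    proof -
      have "(real n - real m) * (real k - 1) \<ge> 0"
        using assms by (simp add: k_def)
      then have "(real m - real k) * (2 * real n - real k - 1) \<le> (real n - real k) * (2 * real m - real k - 1)"
        by (simp add: algebra_simps)
      then have "(real m - real k) / (2 * real m - real k - 1) \<le> (real n - real k) / (2 * real n - real k - 1)"
        using pos[of m] pos[of n] True assms by (simp add: pos_divide_le_eq pos_le_divide_eq)
      then show ?thesis
        unfolding f_def by (rule mult_left_mono) simp
    qed
    moreover have "f m \<ge> 0"
      unfolding f_def using True by (intro divide_nonneg_nonneg mult_nonneg_nonneg) auto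
    ultimately have "f m * (fps_nth (zcat ^ k) m * fps_nth zcat n) \<le> f n * (fps_nth (zcat ^ k) n * fps_nth zcat m)"
      using Suc unfolding k_def
      by (intro mult_mono[of "f m" "f n"]) (simp_all add: zcat_power_nonneg zcat_nonneg del: power_Suc)
    then show ?thesis
      using True assms f[of m] f[of n] by (simp add: k_def[symmetric] mult.assoc del: power_Suc)
  qed
qed

section \<open>Log-convexity of the coefficients of \<open>H\<close>\<close>

text \<open>
  This is the expansion \<open>H = \<Sum> q\<^sup>d u\<^sup>d\<close>, obtained by comparing powers of \<open>q\<close> in \<open>H = 1 + q u H\<close>.
\<close>

lemma H_nth_nth: "fps_nth (fps_nth H n) d = fps_nth (zcat ^ d) n"
proof (induction d arbitrary: n)
  define U where "U = Abs_fps (\<lambda>n. fps_const (fps_nth zcat n))"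
  have U_nth: "fps_nth U k = fps_const (fps_nth zcat k)" for k
    by (simp add: U_def)
  have U: "sqrt_1_minus_4z = 1 - 2 * U"
    by (simp add: fps_eq_iff sqrt_1_minus_4z_def U_def zcat_def numeral_fps_const fps_one_nth)
  have "2 * (H - qvar * (U * H)) = (2 - qvar + qvar * sqrt_1_minus_4z) * H"
    unfolding U by (simp add: algebra_simps)
  also have "\<dots> = 2 * 1"
    by (simp add: H_denominator)
  finally have "H - qvar * (U * H) = 1"
    by (metis mult_left_cancel zero_neq_numeral)
  then have H: "H = 1 + qvar * (U * H)"
    by (simp add: algebra_simps)
  have step: "fps_nth H n = fps_nth 1 n + fps_X * (\<Sum>i=0..n. fps_const (fps_nth zcat i) * fps_nth H (n - i))" for n
    by (subst H) (simp add: qvar_def fps_mult_nth[of U] U_nth)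
  {
    case 0
    show ?case by (subst step) (simp add: fps_one_nth)
  next
    case (Suc d)
    show ?case
      by (subst step) (simp add: fps_sum_nth Suc.IH fps_mult_nth[of zcat] fps_one_nth)
  }
qed

lemma H_nth_0: "fps_nth H 0 = 1"
  by (simp add: fps_eq_iff H_nth_nth fps_one_nth zcat_nth_0)

text \<open>
  At \<open>q\<^sup>e\<^sup>+\<^sup>2\<close> this is the coefficient of \<open>z\<^sup>n\<^sup>+\<^sup>1\<close> in \<open>u\<^sup>e\<^sup>+\<^sup>2 = u\<^sup>e\<^sup>+\<^sup>1 - z u\<^sup>e\<close>.  The last term is
  the boundary contribution at \<open>q\<^sup>1\<close>.
\<close>

lemma H_nth_Suc:
  "(fps_X - 1) * fps_nth H (Suc n) = fps_X\<^sup>2 * fps_nth H n - fps_X * fps_const (fps_nth zcat (Suc n))"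
proof (rule fps_ext)
  fix d
  consider "d = 0" | "d = 1" | e where "d = Suc (Suc e)"
    by (metis One_nat_def not0_implies_Suc)
  then show "fps_nth ((fps_X - 1) * fps_nth H (Suc n)) d
    = fps_nth (fps_X\<^sup>2 * fps_nth H n - fps_X * fps_const (fps_nth zcat (Suc n))) d"
  proof cases
    case 3
    then show ?thesis
      using arg_cong[OF zcat_power_rec[of e], of "\<lambda>F. fps_nth F (Suc n)"]
      by (simp add: left_diff_distrib power2_eq_square mult.assoc H_nth_nth del: power_Suc)
  qed (simp_all add: left_diff_distrib power2_eq_square mult.assoc H_nth_nth)
qed

text \<open>
  The quadratic minor is linear in the polynomials: after multiplication by \<open>q - 1\<close>, the
  recurrence turns the left side into a combination in which the two
  multiples of \<open>P i P j\<close> cancel.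
\<close>

lemma H_minor:
  "fps_X * (fps_nth H i * fps_nth H (Suc j) - fps_nth H (Suc i) * fps_nth H j)
    = fps_const (fps_nth zcat (Suc i)) * fps_nth H (Suc j)
      - fps_const (fps_nth zcat (Suc j)) * fps_nth H (Suc i)" (is "?L = ?R")
proof -
  have "(fps_X - 1) * ?L
      = fps_X * (fps_nth H i * ((fps_X - 1) * fps_nth H (Suc j)) - ((fps_X - 1) * fps_nth H (Suc i)) * fps_nth H j)"
    by (simp add: algebra_simps)
  also have "\<dots> = fps_const (fps_nth zcat (Suc i)) * ((fps_X - 1) * fps_nth H (Suc j))
      - fps_const (fps_nth zcat (Suc j)) * ((fps_X - 1) * fps_nth H (Suc i))"
    unfolding H_nth_Suc by (simp add: algebra_simps power2_eq_square)
  also have "\<dots> = (fps_X - 1) * ?R"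
    by (simp add: algebra_simps)
  finally have "(fps_X - 1) * ?L = (fps_X - 1) * ?R" .
  moreover have "(fps_X :: real fps) - 1 \<noteq> 0"
    by simp
  ultimately show ?thesis
    by (metis mult_left_cancel)
qed

lemma H_minor_nonneg:
  assumes "i \<le> j"
  shows "fps_nth (fps_nth H i * fps_nth H (Suc j) - fps_nth H (Suc i) * fps_nth H j) c \<ge> 0"
proof -
  have "fps_nth (fps_nth H i * fps_nth H (Suc j) - fps_nth H (Suc i) * fps_nth H j) c
     = fps_nth (fps_X * (fps_nth H i * fps_nth H (Suc j) - fps_nth H (Suc i) * fps_nth H j)) (Suc c)"
    by simp
  also have "\<dots> \<ge> 0"
    unfolding H_minor
    using zcat_power_tp2[of "Suc i" "Suc j" c] assms
    by (simp add: H_nth_nth mult.commute del: power_Suc)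
  finally show ?thesis .
qed

section \<open>Two factors\<close>

text \<open>
  Raising \<open>b\<close> by one multiplies the binomial coefficient with \<open>k\<close> by \<open>(k + b + 1) / (b + 1)\<close>, which
  favours the larger of \<open>i\<close> and \<open>j\<close>.
\<close>

lemma binomial_tp2:
  assumes "i \<le> j" "a \<le> b"
  shows "(j + a choose a) * (i + b choose b) \<le> (i + a choose a) * (j + b choose b)"
  using assms(2)
proof (induction b rule: dec_induct)
  case (step b)
  define A where "A = (j + a choose a)"
  define A' where "A' = (i + a choose a)"
  have *: "Suc b * (k + Suc b choose Suc b) = (k + Suc b) * (k + b choose b)" for k
    using Suc_times_binomial[of b "k + b"] by simp
  have "Suc b * (A * (i + Suc b choose Suc b)) = (i + Suc b) * (A * (i + b choose b))"
    using *[of i] by (metis mult.left_commute)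
  also have "\<dots> \<le> (j + Suc b) * (A' * (j + b choose b))"
    using step.IH assms(1) unfolding A_def A'_def by - (rule mult_le_mono, simp_all)
  also have "\<dots> = Suc b * (A' * (j + Suc b choose Suc b))"
    using *[of j] by (metis mult.left_commute)
  finally show ?case
    unfolding A_def A'_def using mult_le_cancel1 zero_less_Suc by blast
qed (simp add: mult.commute)

definition coeffs_nonneg :: "real fps fps \<Rightarrow> bool" where
  "coeffs_nonneg F \<longleftrightarrow> (\<forall>n c. fps_nth (fps_nth F n) c \<ge> 0)"

lemma coeffs_nonneg_mult:
  "coeffs_nonneg F \<Longrightarrow> coeffs_nonneg G \<Longrightarrow> coeffs_nonneg (F * G)"
  by (simp add: coeffs_nonneg_def fps_mult_nth fps_sum_nth sum_nonneg)

lemma coeffs_nonneg_prod: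
  "(\<And>i. i \<in> A \<Longrightarrow> coeffs_nonneg (F i)) \<Longrightarrow> coeffs_nonneg (prod F A)"
proof (induction A rule: infinite_finite_induct)
  case (insert x A)
  then show ?case by (simp add: coeffs_nonneg_mult)
qed (simp_all add: coeffs_nonneg_def fps_one_nth)

lemma Hj_nth: "fps_nth (Hj j) n = of_nat ((n + j) choose j) * fps_nth H n"
  by (simp add: Hj_def Omega_def)

lemma coeffs_nonneg_Hj: "coeffs_nonneg (Hj j)"
  by (simp add: coeffs_nonneg_def Hj_nth fps_of_nat[symmetric] H_nth_nth zcat_power_nonneg)

text \<open>
  With \<open>t k = binom (k + a) (a + 1) * binom (n + 1 - k + b + 1) (b + 1)\<close>, two applications of Pascal's
  rule show that the binomial weights of \<open>P k P (n + 1 - k)\<close> in the two products differ by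
  \<open>t (k + 1) - t k\<close>.  Summation by parts moves the difference to the products \<open>P k P (n + 1 - k)\<close>.
\<close>

lemma Hj_balance_nth:
  fixes a b n
  defines "T \<equiv> \<lambda>i. of_nat ((i + Suc a choose Suc a) * (n - i + Suc b choose Suc b)) :: real fps"
    and "V \<equiv> \<lambda>i. fps_nth H i * fps_nth H (Suc (n - i)) - fps_nth H (Suc i) * fps_nth H (n - i)"
  shows "fps_nth (Hj a * Hj (Suc b) - Hj (Suc a) * Hj b) (Suc n) = (\<Sum>i=0..n. T i * V i)"
proof -
  define t :: "nat \<Rightarrow> real fps"
    where "t k = of_nat ((k + a choose Suc a) * (Suc n - k + Suc b choose Suc b))" for k
  define W where "W k = fps_nth H k * fps_nth H (Suc n - k)" for k
  \<comment> \<open>At \<open>k = n + 1\<close> the value \<open>t (n + 2)\<close> should be 0, but truncated subtraction would give 1 for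
    its second binomial coefficient; hence the case distinction.\<close>
  have summand: "of_nat ((k + a choose a) * (Suc n - k + Suc b choose Suc b))
      - of_nat ((k + Suc a choose Suc a) * (Suc n - k + b choose b))
      = (if k = Suc n then 0 else T k) - t k" if "k \<le> Suc n" for k
  proof (cases "k = Suc n")
    case True
    then show ?thesis by (simp add: t_def algebra_simps)
  next
    case False
    then obtain m where m: "n = k + m"
      using \<open>k \<le> Suc n\<close> by (metis le_SucE le_iff_add)
    show ?thesis
      by (simp add: t_def T_def m algebra_simps)
  qed
  have t_Suc: "t (Suc k) = T k" if "k \<le> n" for k
    by (simp add: t_def T_def)
  have t0: "t 0 = 0" by (simp add: t_def)
  have "fps_nth (Hj a * Hj (Suc b) - Hj (Suc a) * Hj b) (Suc n)
      = (\<Sum>k=0..Suc n. (of_nat ((k + a choose a) * (Suc n - k + Suc b choose Suc b))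
      - of_nat ((k + Suc a choose Suc a) * (Suc n - k + b choose b))) * W k)"
    unfolding fps_sub_nth fps_mult_nth sum_subtractf[symmetric] Hj_nth
    by (intro sum.cong refl) (simp add: W_def algebra_simps del: binomial_Suc_Suc)
  also have "\<dots> = (\<Sum>k=0..Suc n. ((if k = Suc n then 0 else T k) - t k) * W k)"
    by (intro sum.cong refl) (simp only: summand atLeastAtMost_iff)
  also have "\<dots> = (\<Sum>k=0..Suc n. (if k = Suc n then 0 else T k) * W k) - (\<Sum>k=0..Suc n. t k * W k)"
    by (simp only: left_diff_distrib sum_subtractf)
  also have "(\<Sum>k=0..Suc n. (if k = Suc n then 0 else T k) * W k) = (\<Sum>k=0..n. T k * W k)"
    by simp
  also have "(\<Sum>k=0..Suc n. t k * W k) = (\<Sum>k=0..n. t (Suc k) * W (Suc k))"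
    by (simp only: sum.atLeast0_atMost_Suc_shift t0) simp
  also have "\<dots> = (\<Sum>k=0..n. T k * W (Suc k))"
    by (intro sum.cong refl) (simp add: t_Suc)
  also have "(\<Sum>k=0..n. T k * W k) - (\<Sum>k=0..n. T k * W (Suc k)) = (\<Sum>i=0..n. T i * V i)"
    unfolding sum_subtractf[symmetric]
    by (intro sum.cong refl) (simp add: W_def V_def Suc_diff_le algebra_simps)
  finally show ?thesis .
qed

text \<open>
  Exchanging \<open>i\<close> and \<open>m - i\<close> negates \<open>V\<close>, so \<open>T\<close> may be replaced by half its antisymmetric part.
  Then both factors of a term are nonnegative when \<open>i \<le> m - i\<close>, and both are nonpositive
  otherwise.
\<close>

lemma Hj_balance:
  assumes "a \<le> b"
  shows "coeffs_nonneg (Hj a * Hj (Suc b) - Hj (Suc a) * Hj b)"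
  unfolding coeffs_nonneg_def
proof (intro allI)
  fix n c
  show "fps_nth (fps_nth (Hj a * Hj (Suc b) - Hj (Suc a) * Hj b) n) c \<ge> 0"
  proof (cases n)
    case 0
    then show ?thesis by (simp add: Hj_nth H_nth_0)
  next
    case (Suc m)
    define T where "T i = real ((i + Suc a choose Suc a) * (m - i + Suc b choose Suc b))" for i
    define V where "V i = fps_nth (fps_nth H i * fps_nth H (Suc (m - i))
      - fps_nth H (Suc i) * fps_nth H (m - i)) c" for i
    define s where "s = (\<Sum>i=0..m. T i * V i)"
    have coeff: "fps_nth (fps_nth (Hj a * Hj (Suc b) - Hj (Suc a) * Hj b) n) c = s"
      unfolding Suc Hj_balance_nth s_def T_def V_def fps_sum_nth
      by (simp add: fps_of_nat[symmetric] del: binomial_Suc_Suc of_nat_mult)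
    have V_anti: "V (m - i) = - V i" if "i \<le> m" for i
      using that by (simp add: V_def Suc_diff_le mult.commute)
    have "s = (\<Sum>i=0..m. T (m - i) * V (m - i))"
      unfolding s_def by (rule sum.atLeastAtMost_rev[of _ 0 m, simplified])
    also have "\<dots> = (\<Sum>i=0..m. - T (m - i) * V i)"
      by (intro sum.cong refl) (simp add: V_anti)
    also have "\<dots> = - (\<Sum>i=0..m. T (m - i) * V i)"
      by (simp add: sum_negf)
    finally have "2 * s = s - (\<Sum>i=0..m. T (m - i) * V i)"
      by simp
    also have "\<dots> = (\<Sum>i=0..m. (T i - T (m - i)) * V i)"
      by (simp add: s_def left_diff_distrib sum_subtractf)
    finally have "2 * s = (\<Sum>i=0..m. (T i - T (m - i)) * V i)" .
    moreover have "(T i - T (m - i)) * V i \<ge> 0" if "i \<le> m" for i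
    proof -
      have *: "T k \<ge> T (m - k)" "V k \<ge> 0" if "k \<le> m - k" for k
        using binomial_tp2[of k "m - k" "Suc a" "Suc b"] H_minor_nonneg[of k "m - k" c] that assms
        by (simp_all add: T_def V_def del: binomial_Suc_Suc of_nat_mult)
      show ?thesis
      proof (cases "i \<le> m - i")
        case True
        then show ?thesis using *[of i] by simp
      next
        case False
        then show ?thesis using *[of "m - i"] that V_anti[of i]
          by (simp add: mult_nonpos_nonpos)
      qed
    qed
    ultimately have "2 * s \<ge> 0"
      by (metis (no_types, lifting) atLeastAtMost_iff sum_nonneg)
    then show ?thesis
      by (simp only: coeff)
  qed
qed

section \<open>Transfers between entries\<close>

lemma prod_Hj_transfer:
  fixes b :: "nat \<Rightarrow> nat"
  assumes "finite A" "i \<in> A" "j \<in> A" "b j < b i"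
  shows "coeffs_nonneg ((\<Prod>k\<in>A. Hj (b k)) - (\<Prod>k\<in>A. Hj ((b(i := b i - 1, j := b j + 1)) k)))"
proof -
  let ?b = "b(i := b i - 1, j := b j + 1)"
  define R where "R = (\<Prod>k\<in>A - {i} - {j}. Hj (b k))"
  obtain x where x: "b i = Suc x" "b j \<le> x"
    using assms(4) by (metis less_eq_Suc_le Suc_le_D Suc_le_mono)
  have "i \<noteq> j" using assms(4) by auto
  have split: "(\<Prod>k\<in>A. Hj (f k)) = Hj (f i) * (Hj (f j) * (\<Prod>k\<in>A - {i} - {j}. Hj (f k)))" for f
    using assms \<open>i \<noteq> j\<close> by (simp add: prod.remove[of A i] prod.remove[of "A - {i}" j])
  have "(\<Prod>k\<in>A - {i} - {j}. Hj (?b k)) = R"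
    unfolding R_def by (intro prod.cong refl) auto
  then have "(\<Prod>k\<in>A. Hj (b k)) - (\<Prod>k\<in>A. Hj (?b k))
      = (Hj (b j) * Hj (Suc x) - Hj (Suc (b j)) * Hj x) * R"
    using \<open>i \<noteq> j\<close> x unfolding split[of b] split[of ?b] by (simp add: R_def algebra_simps)
  then show ?thesis
    using Hj_balance[OF x(2)] by (simp add: R_def coeffs_nonneg_mult coeffs_nonneg_prod coeffs_nonneg_Hj)
qed

text \<open>
  If \<open>b\<close> differs from \<open>a\<close>, equality of the sums provides \<open>i\<close> with \<open>b i > a i\<close> and \<open>j\<close> with
  \<open>b j < a j\<close>; equitability of \<open>a\<close> then gives \<open>b j < a j \<le> a i + 1 \<le> b i\<close>, and a transfer from \<open>i\<close>
  to \<open>j\<close> brings \<open>b\<close> closer to \<open>a\<close> in the \<open>l\<^sup>1\<close> distance.  When \<open>b i = b j + 1\<close> the transfer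
  merely swaps two entries, so descending to \<open>a\<close> itself also covers the passage between
  equitable sequences that are rearrangements of one another.
\<close>

lemma prod_Hj_equitable_le:
  fixes a b :: "nat \<Rightarrow> nat"
  assumes fin: "finite A"
    and eq: "\<And>i j. i \<in> A \<Longrightarrow> j \<in> A \<Longrightarrow> a j \<le> Suc (a i)"
    and "sum a A = sum b A"
  shows "coeffs_nonneg ((\<Prod>i\<in>A. Hj (b i)) - (\<Prod>i\<in>A. Hj (a i)))"
  using assms(3)
proof (induction "\<Sum>i\<in>A. nat \<bar>int (b i) - int (a i)\<bar>" arbitrary: b rule: less_induct)
  case less
  show ?case
  proof (cases "\<forall>i\<in>A. b i \<le> a i")
    case True
    then have "\<forall>i\<in>A. b i = a i"
      using less.prems fin by (metis le_less sum_strict_mono_ex1 nat_less_le)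
    then have "(\<Prod>i\<in>A. Hj (b i)) = (\<Prod>i\<in>A. Hj (a i))"
      by (intro prod.cong) auto
    then show ?thesis by (simp add: coeffs_nonneg_def)
  next
    case False
    then obtain i where i: "i \<in> A" "a i < b i" by force
    obtain j where j: "j \<in> A" "b j < a j"
      using i less.prems fin sum_strict_mono_ex1[of A a b] by (metis less_irrefl not_le)
    have lt: "b j < b i" using eq[OF i(1) j(1)] i j by simp
    let ?b = "b(i := b i - 1, j := b j + 1)"
    have "i \<noteq> j" using lt by auto
    have split: "sum f A = f i + (f j + sum f (A - {i} - {j}))" for f :: "nat \<Rightarrow> nat"
      using i j fin \<open>i \<noteq> j\<close> by (simp add: sum.remove[of A i] sum.remove[of "A - {i}" j])
    have sum_b: "sum ?b A = sum b A"
      unfolding split[of b] split[of ?b] using i \<open>i \<noteq> j\<close> by simp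
    have "(\<Sum>i\<in>A. nat \<bar>int (?b i) - int (a i)\<bar>) < (\<Sum>i\<in>A. nat \<bar>int (b i) - int (a i)\<bar>)"
      using i j \<open>i \<noteq> j\<close> fin by (intro sum_strict_mono_ex1) (auto intro!: bexI[of _ i])
    then have "coeffs_nonneg ((\<Prod>i\<in>A. Hj (?b i)) - (\<Prod>i\<in>A. Hj (a i)))"
      using less.hyps[of ?b] less.prems sum_b by simp
    moreover have "coeffs_nonneg ((\<Prod>k\<in>A. Hj (b k)) - (\<Prod>k\<in>A. Hj (?b k)))"
      using fin i(1) j(1) lt by (rule prod_Hj_transfer)
    ultimately show ?thesis
      unfolding coeffs_nonneg_def fps_sub_nth by (meson diff_ge_0_iff_ge order_trans)
  qed
qed

theorem mainTheorem8:
  fixes r l :: nat and a b :: "nat \<Rightarrow> nat" and n c :: nat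
  assumes "equitable r a"
    and "(\<Sum>i=0..r. a i) = l"
    and "(\<Sum>i=0..r. b i) = l"
  shows "fps_nth (fps_nth (\<Prod>i=0..r. Hj (a i)) n) c
       \<le> fps_nth (fps_nth (\<Prod>i=0..r. Hj (b i)) n) c"
proof -
  have "a j \<le> Suc (a i)" if "i \<in> {0..r}" "j \<in> {0..r}" for i j
    using assms(1) that unfolding equitable_def by fastforce
  then have "coeffs_nonneg ((\<Prod>i=0..r. Hj (b i)) - (\<Prod>i=0..r. Hj (a i)))"
    using assms(2,3) by (intro prod_Hj_equitable_le) auto
  then show ?thesis
    by (simp add: coeffs_nonneg_def)
qed

end
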